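(* Let $\gamma>0$. There is a monoidal natural transformation $\mathsf{Euler}^\gamma\colon\mathsf{NDD}\Rightarrow\mathsf{NDD}_D$ whose component at a finite set $N$, $\mathsf{Euler}^\gamma_N\colon\mathsf{NDD}(N)\to\mathsf{NDD}_D(N)$, is given by $\upsilon\mapsto\eta_{\mathbb{R}^N}\boxplus\gamma\upsilon$.
   Context: $(\mathbf{FinSet},+)$ is finite sets with disjoint union as monoidal product; $(\mathbf{Set},\times)$ is sets with Cartesian product. $P\colon\mathbf{Set}\to\mathbf{Set}$ is the covariant powerset functor: $P(X)$ is the set of all subsets of $X$, and $P(f)(A)$ is the image of $A$ under $f$. $\eta_X\colon X\to PX$ is $x\mapsto\{x\}$. For a finite set $N$, $\mathbb{R}^N$ is the vector space of functions $N\to\mathbb{R}$. For $\phi\colon N\to M$, $\phi^*\colon\mathbb{R}^M\to\mathbb{R}^N$ is $\phi^*(y)_i=y_{\phi(i)}$ and $\phi_*\colon\mathbb{R}^N\to\mathbb{R}^M$ is $\phi_*(x)_j=\sum_{i\in\phi^{-1}(j)}x_i$. $\iota_N,\iota_M$ are the inclusions of $N,M$ into $N+M$. $A\boxplus B=\{a+b\mid a\in A,b\in B\}$ is the Minkowski sum, $A\boxminus B=A\boxplus(-B)$, and $\gamma A=\{\gamma a\mid a\in A\}$; all are applied pointwise to set-valued functions. $\mathsf{NDD},\mathsf{NDD}_D\colon(\mathbf{FinSet},+)\to(\mathbf{Set},\times)$ are the lax symmetric monoidal functors with $\mathsf{NDD}(N)=\mathsf{NDD}_D(N)$ the set of functions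 $\mathbb{R}^N\to P\mathbb{R}^N$; on $\phi\colon N\to M$, $\mathsf{NDD}(\phi)(\upsilon)=P\phi_*\circ\upsilon\circ\phi^*$ and $\mathsf{NDD}_D(\phi)(\upsilon)=\eta_{\mathbb{R}^M}\boxplus(P\phi_*\circ(\upsilon\boxminus\eta_{\mathbb{R}^N})\circ\phi^* )$; both have product comparison $(\upsilon,\rho)\mapsto(P\iota_{N*}\circ\upsilon\circ\iota_N^* )\boxplus(P\iota_{M*}\circ\rho\circ\iota_M^* )$ and unit comparison picking the function $0\mapsto\{0\}$ on $\mathbb{R}^0$. *)

theory Defs
  imports Complex_Main "HOL-Library.FuncSet"
begin

section \<open>The symmetric monoidal category of finite sets and disjoint union\<close>

text \<open>
  A lax monoidal functor has to be evaluated at N, M and N + M alike, so all objects must be sets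
  over one type that is closed under disjoint union. The type below is the free such type over an
  arbitrary type of atoms; a finite set over the type of atoms is represented by its image under
  \<open>Atom\<close>. A morphism from N to M is an element of \<open>N \<rightarrow>\<^sub>E M\<close>, so that equality of morphisms is
  equality in HOL; composites are formed with \<open>compose\<close>. The same convention is used for the
  category of sets, whose monoidal product is the HOL product and whose unit is the type unit.
\<close>

datatype 'a elem = Atom 'a | InL "'a elem" | InR "'a elem"

definition dsum :: "'a elem set \<Rightarrow> 'a elem set \<Rightarrow> 'a elem set"  (infixr \<open>\<uplus>\<close> 65)
  where "N \<uplus> M = InL ` N \<union> InR ` M"

definition inl :: "'a elem set \<Rightarrow> 'a elem \<Rightarrow> 'a elem"
  where "inl N = (\<lambda>i\<in>N. InL i)"

definition inr :: "'a elem set \<Rightarrow> 'a elem \<Rightarrow> 'a elem"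
  where "inr M = (\<lambda>j\<in>M. InR j)"

definition copair ::
    "'a elem set \<Rightarrow> 'a elem set \<Rightarrow> ('a elem \<Rightarrow> 'b) \<Rightarrow> ('a elem \<Rightarrow> 'b) \<Rightarrow> 'a elem \<Rightarrow> 'b"
  where "copair N M f g =
    (\<lambda>z\<in>N \<uplus> M. case z of InL i \<Rightarrow> f i | InR j \<Rightarrow> g j | Atom a \<Rightarrow> undefined)"

definition dsum_map ::
    "'a elem set \<Rightarrow> 'a elem set \<Rightarrow> ('a elem \<Rightarrow> 'a elem) \<Rightarrow> ('a elem \<Rightarrow> 'a elem) \<Rightarrow> 'a elem \<Rightarrow> 'a elem"
  where "dsum_map N M \<phi> \<psi> = copair N M (InL \<circ> \<phi>) (InR \<circ> \<psi>)"

definition dsum_assoc :: "'a elem set \<Rightarrow> 'a elem set \<Rightarrow> 'a elem set \<Rightarrow> 'a elem \<Rightarrow> 'a elem"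
  where "dsum_assoc N M K =
    copair (N \<uplus> M) K (copair N M InL (InR \<circ> InL)) (InR \<circ> InR)"

definition dsum_lunit :: "'a elem set \<Rightarrow> 'a elem \<Rightarrow> 'a elem"
  where "dsum_lunit N = copair {} N (\<lambda>_. undefined) (\<lambda>i. i)"

definition dsum_runit :: "'a elem set \<Rightarrow> 'a elem \<Rightarrow> 'a elem"
  where "dsum_runit N = copair N {} (\<lambda>i. i) (\<lambda>_. undefined)"

definition dsum_swap :: "'a elem set \<Rightarrow> 'a elem set \<Rightarrow> 'a elem \<Rightarrow> 'a elem"
  where "dsum_swap N M = copair N M InR InL"


section \<open>Lax symmetric monoidal functors from (FinSet, +) to (Set, \<times>)\<close>

record ('a, 's) functor_data =
  obj :: "'a elem set \<Rightarrow> 's set"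
  arr :: "'a elem set \<Rightarrow> 'a elem set \<Rightarrow> ('a elem \<Rightarrow> 'a elem) \<Rightarrow> 's \<Rightarrow> 's"
  prod_cmp :: "'a elem set \<Rightarrow> 'a elem set \<Rightarrow> 's \<times> 's \<Rightarrow> 's"
  unit_cmp :: "unit \<Rightarrow> 's"

locale lax_symmetric_monoidal_functor =
  fixes F :: "('a, 's) functor_data"
  assumes arr_mem:
      "\<lbrakk>finite N; finite M; \<phi> \<in> N \<rightarrow>\<^sub>E M\<rbrakk> \<Longrightarrow> arr F N M \<phi> \<in> obj F N \<rightarrow>\<^sub>E obj F M"
    and arr_id:
      "finite N \<Longrightarrow> arr F N N (\<lambda>i\<in>N. i) = (\<lambda>x\<in>obj F N. x)"
    and arr_comp:
      "\<lbrakk>finite N; finite M; finite K; \<phi> \<in> N \<rightarrow>\<^sub>E M; \<psi> \<in> M \<rightarrow>\<^sub>E K\<rbrakk>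
        \<Longrightarrow> arr F N K (compose N \<psi> \<phi>) = compose (obj F N) (arr F M K \<psi>) (arr F N M \<phi>)"
    and prod_cmp_mem:
      "\<lbrakk>finite N; finite M\<rbrakk> \<Longrightarrow> prod_cmp F N M \<in> obj F N \<times> obj F M \<rightarrow>\<^sub>E obj F (N \<uplus> M)"
    and unit_cmp_mem:
      "unit_cmp F \<in> UNIV \<rightarrow> obj F {}"
    and prod_cmp_natural:
      "\<lbrakk>finite N; finite M; finite N'; finite M'; \<phi> \<in> N \<rightarrow>\<^sub>E N'; \<psi> \<in> M \<rightarrow>\<^sub>E M';
        x \<in> obj F N; y \<in> obj F M\<rbrakk>
        \<Longrightarrow> arr F (N \<uplus> M) (N' \<uplus> M') (dsum_map N M \<phi> \<psi>) (prod_cmp F N M (x, y)) =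
            prod_cmp F N' M' (arr F N N' \<phi> x, arr F M M' \<psi> y)"
    and prod_cmp_assoc:
      "\<lbrakk>finite N; finite M; finite K; x \<in> obj F N; y \<in> obj F M; z \<in> obj F K\<rbrakk>
        \<Longrightarrow> arr F ((N \<uplus> M) \<uplus> K) (N \<uplus> (M \<uplus> K)) (dsum_assoc N M K)
              (prod_cmp F (N \<uplus> M) K (prod_cmp F N M (x, y), z)) =
            prod_cmp F N (M \<uplus> K) (x, prod_cmp F M K (y, z))"
    and prod_cmp_lunit:
      "\<lbrakk>finite N; x \<in> obj F N\<rbrakk>
        \<Longrightarrow> arr F ({} \<uplus> N) N (dsum_lunit N) (prod_cmp F {} N (unit_cmp F (), x)) = x"
    and prod_cmp_runit:
      "\<lbrakk>finite N; x \<in> obj F N\<rbrakk>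
        \<Longrightarrow> arr F (N \<uplus> {}) N (dsum_runit N) (prod_cmp F N {} (x, unit_cmp F ())) = x"
    and prod_cmp_swap:
      "\<lbrakk>finite N; finite M; x \<in> obj F N; y \<in> obj F M\<rbrakk>
        \<Longrightarrow> arr F (N \<uplus> M) (M \<uplus> N) (dsum_swap N M) (prod_cmp F N M (x, y)) =
            prod_cmp F M N (y, x)"

locale monoidal_natural_transformation =
  F: lax_symmetric_monoidal_functor F + G: lax_symmetric_monoidal_functor G
  for F :: "('a, 's) functor_data" and G :: "('a, 't) functor_data" +
  fixes \<alpha> :: "'a elem set \<Rightarrow> 's \<Rightarrow> 't"
  assumes component_mem:
      "finite N \<Longrightarrow> \<alpha> N \<in> obj F N \<rightarrow>\<^sub>E obj G N"
    and naturality: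
      "\<lbrakk>finite N; finite M; \<phi> \<in> N \<rightarrow>\<^sub>E M\<rbrakk>
        \<Longrightarrow> compose (obj F N) (\<alpha> M) (arr F N M \<phi>) = compose (obj F N) (arr G N M \<phi>) (\<alpha> N)"
    and monoidal_prod:
      "\<lbrakk>finite N; finite M; x \<in> obj F N; y \<in> obj F M\<rbrakk>
        \<Longrightarrow> \<alpha> (N \<uplus> M) (prod_cmp F N M (x, y)) = prod_cmp G N M (\<alpha> N x, \<alpha> M y)"
    and monoidal_unit:
      "\<alpha> {} (unit_cmp F ()) = unit_cmp G ()"


section \<open>Vectors indexed by finite sets and Minkowski operations\<close>

definition rvec :: "'b set \<Rightarrow> ('b \<Rightarrow> real) set"
  where "rvec N = N \<rightarrow>\<^sub>E UNIV"

definition pull :: "'b set \<Rightarrow> 'c set \<Rightarrow> ('b \<Rightarrow> 'c) \<Rightarrow> ('c \<Rightarrow> real) \<Rightarrow> 'b \<Rightarrow> real"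
  where "pull N M \<phi> = (\<lambda>y\<in>rvec M. \<lambda>i\<in>N. y (\<phi> i))"

definition push :: "'b set \<Rightarrow> 'c set \<Rightarrow> ('b \<Rightarrow> 'c) \<Rightarrow> ('b \<Rightarrow> real) \<Rightarrow> 'c \<Rightarrow> real"
  where "push N M \<phi> = (\<lambda>x\<in>rvec N. \<lambda>j\<in>M. \<Sum>i\<in>{i\<in>N. \<phi> i = j}. x i)"

definition mink_sum :: "'b set \<Rightarrow> ('b \<Rightarrow> real) set \<Rightarrow> ('b \<Rightarrow> real) set \<Rightarrow> ('b \<Rightarrow> real) set"
  where "mink_sum N A B = {\<lambda>i\<in>N. a i + b i | a b. a \<in> A \<and> b \<in> B}"

definition mink_scale :: "'b set \<Rightarrow> real \<Rightarrow> ('b \<Rightarrow> real) set \<Rightarrow> ('b \<Rightarrow> real) set"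
  where "mink_scale N c A = {\<lambda>i\<in>N. c * a i | a. a \<in> A}"

definition mink_diff :: "'b set \<Rightarrow> ('b \<Rightarrow> real) set \<Rightarrow> ('b \<Rightarrow> real) set \<Rightarrow> ('b \<Rightarrow> real) set"
  where "mink_diff N A B = mink_sum N A (mink_scale N (- 1) B)"

text \<open>Set-valued functions on \<open>rvec N\<close>, with the Minkowski operations applied pointwise.\<close>

type_synonym 'b svfun = "('b \<Rightarrow> real) \<Rightarrow> ('b \<Rightarrow> real) set"

definition svfuns :: "'b set \<Rightarrow> 'b svfun set"
  where "svfuns N = rvec N \<rightarrow>\<^sub>E Pow (rvec N)"

definition sv_eta :: "'b set \<Rightarrow> 'b svfun"
  where "sv_eta N = (\<lambda>x\<in>rvec N. {x})"

definition sv_sum :: "'b set \<Rightarrow> 'b svfun \<Rightarrow> 'b svfun \<Rightarrow> 'b svfun"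
  where "sv_sum N \<upsilon> \<rho> = (\<lambda>x\<in>rvec N. mink_sum N (\<upsilon> x) (\<rho> x))"

definition sv_diff :: "'b set \<Rightarrow> 'b svfun \<Rightarrow> 'b svfun \<Rightarrow> 'b svfun"
  where "sv_diff N \<upsilon> \<rho> = (\<lambda>x\<in>rvec N. mink_diff N (\<upsilon> x) (\<rho> x))"

definition sv_scale :: "'b set \<Rightarrow> real \<Rightarrow> 'b svfun \<Rightarrow> 'b svfun"
  where "sv_scale N c \<upsilon> = (\<lambda>x\<in>rvec N. mink_scale N c (\<upsilon> x))"

text \<open>The composite of pullback along \<open>\<phi>\<close>, \<open>\<upsilon>\<close>, and the direct image under pushforward along \<open>\<phi>\<close>.\<close>

definition sv_push :: "'b set \<Rightarrow> 'c set \<Rightarrow> ('b \<Rightarrow> 'c) \<Rightarrow> 'b svfun \<Rightarrow> 'c svfun"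
  where "sv_push N M \<phi> \<upsilon> = (\<lambda>y\<in>rvec M. push N M \<phi> ` \<upsilon> (pull N M \<phi> y))"


section \<open>The functors NDD and \<open>NDD_D\<close>\<close>

definition sv_prod_cmp ::
    "'a elem set \<Rightarrow> 'a elem set \<Rightarrow> 'a elem svfun \<times> 'a elem svfun \<Rightarrow> 'a elem svfun"
  where "sv_prod_cmp N M = (\<lambda>(\<upsilon>, \<rho>)\<in>svfuns N \<times> svfuns M.
    sv_sum (N \<uplus> M) (sv_push N (N \<uplus> M) (inl N) \<upsilon>) (sv_push M (N \<uplus> M) (inr M) \<rho>))"

definition sv_unit_cmp :: "unit \<Rightarrow> 'a elem svfun"
  where "sv_unit_cmp = (\<lambda>_. \<lambda>x\<in>rvec {}. {\<lambda>i\<in>{}. 0})"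

definition NDD :: "('a, 'a elem svfun) functor_data"
  where "NDD =
    \<lparr>obj = svfuns,
     arr = (\<lambda>N M \<phi>. \<lambda>\<upsilon>\<in>svfuns N. sv_push N M \<phi> \<upsilon>),
     prod_cmp = sv_prod_cmp,
     unit_cmp = sv_unit_cmp\<rparr>"

definition NDD_D :: "('a, 'a elem svfun) functor_data"
  where "NDD_D =
    \<lparr>obj = svfuns,
     arr = (\<lambda>N M \<phi>. \<lambda>\<upsilon>\<in>svfuns N.
       sv_sum M (sv_eta M) (sv_push N M \<phi> (sv_diff N \<upsilon> (sv_eta N)))),
     prod_cmp = sv_prod_cmp,
     unit_cmp = sv_unit_cmp\<rparr>"

end

theory Submission
  imports Defs
begin

text \<open>
  The transformation factors as a composite of two monoidal natural transformations.

  The first is scaling \<open>\<upsilon> \<mapsto> \<gamma>\<upsilon>\<close>, an endomorphism of \<open>NDD\<close>: everything in sight is built from the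
  linear maps \<open>\<phi>\<^sub>*\<close> and Minkowski sums, and both commute with multiplication by a scalar.

  The second is the translation \<open>\<upsilon> \<mapsto> \<eta> \<boxplus> \<upsilon>\<close>, which replaces a displacement by the point it leads
  to. It is invertible, with inverse \<open>\<upsilon> \<mapsto> \<upsilon> \<boxminus> \<eta>\<close>, since \<open>\<eta>\<close> has singleton values and so
  \<open>\<eta> \<boxminus> \<eta> = 0\<close>, although Minkowski sums do not cancel in general. By its very definition the action of
  \<open>NDD_D\<close> on morphisms is the action of \<open>NDD\<close> conjugated by this bijection. The translation also
  respects the product comparison, because a vector on \<open>N \<uplus> M\<close> is the sum of its two restrictions
  extended by zero, that is, the comparison sends \<open>(\<eta>, \<eta>)\<close> to \<open>\<eta>\<close>. Hence the whole functor \<open>NDD_D\<close>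
  is \<open>NDD\<close> with its structure transported along a bijection, and inherits all
  the axioms of a lax symmetric monoidal functor (lemma \<open>transport_of_structure\<close>).

  What remains is that \<open>NDD\<close> is itself lax symmetric monoidal. Since \<open>\<upsilon> \<mapsto> \<phi>\<^sub>* \<circ> \<upsilon> \<circ> \<phi>\<^sup>*\<close> is
  functorial in \<open>\<phi>\<close> and additive in \<open>\<upsilon>\<close>, pushing the product comparison forward along \<open>\<chi>\<close> gives the
  Minkowski sum of the pushforwards along the two legs \<open>\<chi> \<circ> \<iota>\<^sub>N\<close> and \<open>\<chi> \<circ> \<iota>\<^sub>M\<close>
  (lemma \<open>sv_push_sv_prod_cmp\<close>). Each coherence axiom then reduces to the commutative monoid laws of
  \<open>\<boxplus>\<close> and to identities between maps out of a disjoint union.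
\<close>


section \<open>Monoidal natural transformations: composition and transport\<close>

lemma monoidal_natural_transformation_compose:
  assumes "monoidal_natural_transformation F G \<alpha>" "monoidal_natural_transformation G H \<beta>"
  shows "monoidal_natural_transformation F H (\<lambda>N. compose (obj F N) (\<beta> N) (\<alpha> N))"
proof -
  interpret A: monoidal_natural_transformation F G \<alpha> by fact
  interpret B: monoidal_natural_transformation G H \<beta> by fact
  have \<alpha>_mem: "\<alpha> N x \<in> obj G N" if "finite N" "x \<in> obj F N" for N x
    using A.component_mem that by (blast dest: PiE_mem)
  have \<beta>_mem: "\<beta> N x \<in> obj H N" if "finite N" "x \<in> obj G N" for N x
    using B.component_mem that by (blast dest: PiE_mem)
  have F_arr_mem: "arr F N M \<phi> x \<in> obj F M"
    if "finite N" "finite M" "\<phi> \<in> N \<rightarrow>\<^sub>E M" "x \<in> obj F N" for N M \<phi> x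
    using A.F.arr_mem that by (blast dest: PiE_mem)
  have F_prod_mem: "prod_cmp F N M (x, y) \<in> obj F (N \<uplus> M)"
    if "finite N" "finite M" "x \<in> obj F N" "y \<in> obj F M" for N M x y
    using PiE_mem[OF A.F.prod_cmp_mem, of N M "(x, y)"] that by blast
  show ?thesis
  proof
    fix N :: "'a elem set" assume "finite N"
    then show "compose (obj F N) (\<beta> N) (\<alpha> N) \<in> obj F N \<rightarrow>\<^sub>E obj H N"
      by (auto simp: compose_def \<alpha>_mem \<beta>_mem)
  next
    fix N M :: "'a elem set" and \<phi>
    assume *: "finite N" "finite M" "\<phi> \<in> N \<rightarrow>\<^sub>E M"
    have 1: "\<alpha> M (arr F N M \<phi> x) = arr G N M \<phi> (\<alpha> N x)" if "x \<in> obj F N" for x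
      using fun_cong[OF A.naturality[OF *], of x] that by (simp add: compose_def)
    have 2: "\<beta> M (arr G N M \<phi> x) = arr H N M \<phi> (\<beta> N x)" if "x \<in> obj G N" for x
      using fun_cong[OF B.naturality[OF *], of x] that by (simp add: compose_def)
    show "compose (obj F N) (compose (obj F M) (\<beta> M) (\<alpha> M)) (arr F N M \<phi>) =
          compose (obj F N) (arr H N M \<phi>) (compose (obj F N) (\<beta> N) (\<alpha> N))"
      using * by (auto simp: compose_def fun_eq_iff restrict_def F_arr_mem 1 2 \<alpha>_mem)
  next
    fix N M :: "'a elem set" and x y
    assume "finite N" "finite M" "x \<in> obj F N" "y \<in> obj F M"
    then show "compose (obj F (N \<uplus> M)) (\<beta> (N \<uplus> M)) (\<alpha> (N \<uplus> M)) (prod_cmp F N M (x, y)) =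
        prod_cmp H N M (compose (obj F N) (\<beta> N) (\<alpha> N) x, compose (obj F M) (\<beta> M) (\<alpha> M) y)"
      by (simp add: compose_def F_prod_mem A.monoidal_prod B.monoidal_prod \<alpha>_mem)
  next
    show "compose (obj F {}) (\<beta> {}) (\<alpha> {}) (unit_cmp F ()) = unit_cmp H ()"
      using A.F.unit_cmp_mem by (auto simp: compose_def A.monoidal_unit B.monoidal_unit)
  qed
qed

lemma finite_dsum [simp]: "finite N \<Longrightarrow> finite M \<Longrightarrow> finite (N \<uplus> M)"
  by (simp add: dsum_def)

lemma copair_mem:
  assumes "f \<in> N \<rightarrow> X" "g \<in> M \<rightarrow> X"
  shows "copair N M f g \<in> N \<uplus> M \<rightarrow>\<^sub>E X"
  using assms by (auto simp: copair_def dsum_def)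

lemma dsum_map_mem:
  assumes "\<phi> \<in> N \<rightarrow>\<^sub>E N'" "\<psi> \<in> M \<rightarrow>\<^sub>E M'"
  shows "dsum_map N M \<phi> \<psi> \<in> N \<uplus> M \<rightarrow>\<^sub>E N' \<uplus> M'"
  unfolding dsum_map_def using assms by (intro copair_mem) (auto simp: dsum_def)

lemma dsum_assoc_inner_mem: "copair N M InL (InR \<circ> InL) \<in> N \<uplus> M \<rightarrow>\<^sub>E N \<uplus> (M \<uplus> K)"
  by (intro copair_mem) (auto simp: dsum_def)

lemma dsum_assoc_mem: "dsum_assoc N M K \<in> (N \<uplus> M) \<uplus> K \<rightarrow>\<^sub>E N \<uplus> (M \<uplus> K)"
  unfolding dsum_assoc_def
  by (intro copair_mem PiE_mem[OF dsum_assoc_inner_mem] Pi_I) (auto simp: dsum_def)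

lemma dsum_lunit_mem: "dsum_lunit N \<in> {} \<uplus> N \<rightarrow>\<^sub>E N"
  unfolding dsum_lunit_def by (intro copair_mem) auto

lemma dsum_runit_mem: "dsum_runit N \<in> N \<uplus> {} \<rightarrow>\<^sub>E N"
  unfolding dsum_runit_def by (intro copair_mem) auto

lemma dsum_swap_mem: "dsum_swap N M \<in> N \<uplus> M \<rightarrow>\<^sub>E M \<uplus> N"
  unfolding dsum_swap_def by (intro copair_mem) (auto simp: dsum_def)

text \<open>
  Here \<open>s N\<close> is the inverse of the bijection \<open>t N\<close>, and the last hypotheses say that the data of
  \<open>G\<close> are those of \<open>F\<close> carried along \<open>t\<close>. The conclusion includes that \<open>G\<close> is lax symmetric
  monoidal: \<open>t\<close> commutes with all the structure and is onto, so it carries each equational axiom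
  from \<open>F\<close> to \<open>G\<close>.
\<close>

lemma transport_of_structure:
  fixes F :: "('a, 's) functor_data" and G :: "('a, 't) functor_data"
  assumes "lax_symmetric_monoidal_functor F"
    and t: "\<And>N. finite N \<Longrightarrow> t N \<in> obj F N \<rightarrow>\<^sub>E obj G N"
    and s: "\<And>N. finite N \<Longrightarrow> s N \<in> obj G N \<rightarrow> obj F N"
    and s_t: "\<And>N x. finite N \<Longrightarrow> x \<in> obj F N \<Longrightarrow> s N (t N x) = x"
    and t_s: "\<And>N y. finite N \<Longrightarrow> y \<in> obj G N \<Longrightarrow> t N (s N y) = y"
    and arr_G: "\<And>N M \<phi>. \<lbrakk>finite N; finite M; \<phi> \<in> N \<rightarrow>\<^sub>E M\<rbrakk>
      \<Longrightarrow> arr G N M \<phi> = (\<lambda>y\<in>obj G N. t M (arr F N M \<phi> (s N y)))"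
    and prod_G_mem: "\<And>N M. \<lbrakk>finite N; finite M\<rbrakk>
      \<Longrightarrow> prod_cmp G N M \<in> obj G N \<times> obj G M \<rightarrow>\<^sub>E obj G (N \<uplus> M)"
    and prod_G: "\<And>N M x y. \<lbrakk>finite N; finite M; x \<in> obj F N; y \<in> obj F M\<rbrakk>
      \<Longrightarrow> t (N \<uplus> M) (prod_cmp F N M (x, y)) = prod_cmp G N M (t N x, t M y)"
    and unit_G: "t {} (unit_cmp F ()) = unit_cmp G ()"
  shows "monoidal_natural_transformation F G t"
proof -
  interpret F: lax_symmetric_monoidal_functor F by fact
  have t_mem: "t N x \<in> obj G N" if "finite N" "x \<in> obj F N" for N x
    using t that by (blast dest: PiE_mem)
  have s_mem: "s N x \<in> obj F N" if "finite N" "x \<in> obj G N" for N x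
    using s that by blast
  have F_arr_mem: "arr F N M \<phi> x \<in> obj F M"
    if "finite N" "finite M" "\<phi> \<in> N \<rightarrow>\<^sub>E M" "x \<in> obj F N" for N M \<phi> x
    using F.arr_mem that by (blast dest: PiE_mem)
  have F_prod_mem: "prod_cmp F N M (x, y) \<in> obj F (N \<uplus> M)"
    if "finite N" "finite M" "x \<in> obj F N" "y \<in> obj F M" for N M x y
    using PiE_mem[OF F.prod_cmp_mem, of N M "(x, y)"] that by blast
  have F_unit_mem: "unit_cmp F () \<in> obj F {}"
    using F.unit_cmp_mem by auto
  have nat: "arr G N M \<phi> (t N x) = t M (arr F N M \<phi> x)"
    if "finite N" "finite M" "\<phi> \<in> N \<rightarrow>\<^sub>E M" "x \<in> obj F N" for N M \<phi> x
    using that by (simp add: arr_G t_mem s_t)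
  \<comment> \<open>Every element of \<open>obj G N\<close> is \<open>t N x\<close> for some \<open>x\<close>, so each axiom for \<open>G\<close> is the image under
      \<open>t\<close> of the same axiom for \<open>F\<close>.\<close>
  have t_onto: "\<exists>x\<in>obj F N. y = t N x" if "finite N" "y \<in> obj G N" for N y
    using that by (metis t_s s_mem)
  interpret G: lax_symmetric_monoidal_functor G
  proof
    fix N M :: "'a elem set" and \<phi>
    assume "finite N" "finite M" "\<phi> \<in> N \<rightarrow>\<^sub>E M"
    then show "arr G N M \<phi> \<in> obj G N \<rightarrow>\<^sub>E obj G M"
      by (auto simp: arr_G t_mem s_mem F_arr_mem)
  next
    fix N :: "'a elem set" assume "finite N"
    then show "arr G N N (\<lambda>i\<in>N. i) = (\<lambda>x\<in>obj G N. x)"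
      by (auto simp: arr_G F.arr_id s_mem t_s intro!: restrict_ext)
  next
    fix N M K :: "'a elem set" and \<phi> \<psi>
    assume *: "finite N" "finite M" "finite K" "\<phi> \<in> N \<rightarrow>\<^sub>E M" "\<psi> \<in> M \<rightarrow>\<^sub>E K"
    then have "compose N \<psi> \<phi> \<in> N \<rightarrow>\<^sub>E K"
      by (auto simp: compose_def)
    with * show "arr G N K (compose N \<psi> \<phi>) = compose (obj G N) (arr G M K \<psi>) (arr G N M \<phi>)"
      by (auto simp: arr_G F.arr_comp compose_def[of "obj G N"] compose_eq s_mem s_t t_mem
          F_arr_mem intro!: restrict_ext)
  next
    fix N M :: "'a elem set" assume "finite N" "finite M"
    then show "prod_cmp G N M \<in> obj G N \<times> obj G M \<rightarrow>\<^sub>E obj G (N \<uplus> M)"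
      by (rule prod_G_mem)
  next
    show "unit_cmp G \<in> UNIV \<rightarrow> obj G {}"
      using t_mem[OF _ F_unit_mem] by (simp add: unit_G)
  next
    fix N M N' M' :: "'a elem set" and \<phi> \<psi> x y
    assume *: "finite N" "finite M" "finite N'" "finite M'" "\<phi> \<in> N \<rightarrow>\<^sub>E N'" "\<psi> \<in> M \<rightarrow>\<^sub>E M'"
      and "x \<in> obj G N" "y \<in> obj G M"
    then obtain x' y' where "x' \<in> obj F N" "y' \<in> obj F M" "x = t N x'" "y = t M y'"
      by (metis t_onto)
    with * show "arr G (N \<uplus> M) (N' \<uplus> M') (dsum_map N M \<phi> \<psi>) (prod_cmp G N M (x, y)) =
        prod_cmp G N' M' (arr G N N' \<phi> x, arr G M M' \<psi> y)"
      by (simp add: nat dsum_map_mem F_prod_mem F_arr_mem F.prod_cmp_natural flip: prod_G)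
  next
    fix N M K :: "'a elem set" and x y z
    assume *: "finite N" "finite M" "finite K"
      and "x \<in> obj G N" "y \<in> obj G M" "z \<in> obj G K"
    then obtain x' y' z' where "x' \<in> obj F N" "y' \<in> obj F M" "z' \<in> obj F K"
      "x = t N x'" "y = t M y'" "z = t K z'"
      by (metis t_onto)
    with * show "arr G ((N \<uplus> M) \<uplus> K) (N \<uplus> (M \<uplus> K)) (dsum_assoc N M K)
          (prod_cmp G (N \<uplus> M) K (prod_cmp G N M (x, y), z)) =
        prod_cmp G N (M \<uplus> K) (x, prod_cmp G M K (y, z))"
      by (simp add: nat dsum_assoc_mem F_prod_mem F.prod_cmp_assoc flip: prod_G)
  next
    fix N :: "'a elem set" and x assume *: "finite N" and "x \<in> obj G N"
    then obtain x' where "x' \<in> obj F N" "x = t N x'"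
      by (metis t_onto)
    with * show "arr G ({} \<uplus> N) N (dsum_lunit N) (prod_cmp G {} N (unit_cmp G (), x)) = x"
      by (simp add: nat dsum_lunit_mem F_prod_mem F_unit_mem F.prod_cmp_lunit
          flip: prod_G unit_G)
  next
    fix N :: "'a elem set" and x assume *: "finite N" and "x \<in> obj G N"
    then obtain x' where "x' \<in> obj F N" "x = t N x'"
      by (metis t_onto)
    with * show "arr G (N \<uplus> {}) N (dsum_runit N) (prod_cmp G N {} (x, unit_cmp G ())) = x"
      by (simp add: nat dsum_runit_mem F_prod_mem F_unit_mem F.prod_cmp_runit
          flip: prod_G unit_G)
  next
    fix N M :: "'a elem set" and x y
    assume *: "finite N" "finite M" and "x \<in> obj G N" "y \<in> obj G M"
    then obtain x' y' where "x' \<in> obj F N" "y' \<in> obj F M" "x = t N x'" "y = t M y'"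
      by (metis t_onto)
    with * show "arr G (N \<uplus> M) (M \<uplus> N) (dsum_swap N M) (prod_cmp G N M (x, y)) =
        prod_cmp G M N (y, x)"
      by (simp add: nat dsum_swap_mem F_prod_mem F.prod_cmp_swap flip: prod_G)
  qed
  show ?thesis
    by unfold_locales
      (use nat in \<open>auto simp: t prod_G unit_G compose_def fun_eq_iff\<close>)
qed


section \<open>Pullback and pushforward of vectors\<close>

lemma pull_mem: "\<phi> \<in> N \<rightarrow> M \<Longrightarrow> y \<in> rvec M \<Longrightarrow> pull N M \<phi> y \<in> rvec N"
  by (simp add: pull_def rvec_def)

lemma push_mem: "x \<in> rvec N \<Longrightarrow> push N M \<phi> x \<in> rvec M"
  by (simp add: push_def rvec_def)

lemma rvec_restrict_mem [simp]: "(\<lambda>i\<in>N. f i) \<in> rvec N"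
  by (simp add: rvec_def)

lemma rvec_eqI: "x \<in> rvec N \<Longrightarrow> y \<in> rvec N \<Longrightarrow> (\<And>i. i \<in> N \<Longrightarrow> x i = y i) \<Longrightarrow> x = y"
  unfolding rvec_def by (rule PiE_ext)

lemma rvec_restrict_id [simp]: "x \<in> rvec N \<Longrightarrow> (\<lambda>i\<in>N. x i) = x"
  by (rule rvec_eqI) auto

lemma pull_compose:
  assumes "\<phi> \<in> N \<rightarrow> M" "\<psi> \<in> M \<rightarrow> K" "z \<in> rvec K"
  shows "pull N M \<phi> (pull M K \<psi> z) = pull N K (compose N \<psi> \<phi>) z"
  using assms by (auto simp: pull_def compose_def intro!: restrict_ext)

text \<open>
  Summing over the fibres of \<open>\<phi>\<close> within a fibre of \<open>\<psi>\<close> amounts to summing over a fibre of the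
  composite.
\<close>

lemma push_compose:
  assumes "finite N" "finite M" "\<phi> \<in> N \<rightarrow> M" "x \<in> rvec N"
  shows "push M K \<psi> (push N M \<phi> x) = push N K (compose N \<psi> \<phi>) x"
proof (rule rvec_eqI)
  fix k assume k: "k \<in> K"
  have "push M K \<psi> (push N M \<phi> x) k = (\<Sum>j\<in>{j\<in>M. \<psi> j = k}. \<Sum>i\<in>{i\<in>N. \<phi> i = j}. x i)"
    using k assms(4) by (simp add: push_def)
  also have "\<dots> = (\<Sum>j\<in>{j\<in>M. \<psi> j = k}.
      \<Sum>i\<in>{i\<in>{i\<in>N. compose N \<psi> \<phi> i = k}. \<phi> i = j}. x i)"
    by (intro sum.cong) (auto simp: compose_def)
  also have "\<dots> = (\<Sum>i\<in>{i\<in>N. compose N \<psi> \<phi> i = k}. x i)"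
    using assms by (intro sum.group) (auto simp: compose_def)
  also have "\<dots> = push N K (compose N \<psi> \<phi>) x k"
    using k assms(4) by (simp add: push_def)
  finally show "push M K \<psi> (push N M \<phi> x) k = push N K (compose N \<psi> \<phi>) x k" .
qed (use assms in \<open>auto intro: push_mem\<close>)

lemma push_add:
  assumes "x \<in> rvec N" "y \<in> rvec N"
  shows "push N M \<phi> (\<lambda>i\<in>N. x i + y i) = (\<lambda>j\<in>M. push N M \<phi> x j + push N M \<phi> y j)"
  using assms by (auto simp: push_def sum.distrib intro!: restrict_ext)

lemma push_scale:
  assumes "x \<in> rvec N"
  shows "push N M \<phi> (\<lambda>i\<in>N. c * x i) = (\<lambda>j\<in>M. c * push N M \<phi> x j)"
  using assms by (auto simp: push_def sum_distrib_left intro!: restrict_ext)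

lemma pull_id: "y \<in> rvec N \<Longrightarrow> pull N N (\<lambda>i\<in>N. i) y = y"
  by (rule rvec_eqI) (auto simp: pull_def)

lemma push_id:
  assumes "x \<in> rvec N"
  shows "push N N (\<lambda>i\<in>N. i) x = x"
proof (rule rvec_eqI)
  fix j assume "j \<in> N"
  moreover from this have "{i\<in>N. (\<lambda>i\<in>N. i) i = j} = {j}"
    by auto
  ultimately show "push N N (\<lambda>i\<in>N. i) x j = x j"
    using assms by (simp add: push_def)
qed (use assms in \<open>auto intro: push_mem\<close>)

text \<open>
  Pulling back along an injection restricts a vector to one summand and pushing forward extends it
  by zero, so at each coordinate exactly one of the two terms survives. This identity is what makes
  the product comparison send \<open>(\<eta>, \<eta>)\<close> to \<open>\<eta>\<close>.
\<close>

lemma push_pull_inl_plus_push_pull_inr: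
  assumes "x \<in> rvec (N \<uplus> M)"
  shows "(\<lambda>k\<in>N \<uplus> M. push N (N \<uplus> M) (inl N) (pull N (N \<uplus> M) (inl N) x) k
    + push M (N \<uplus> M) (inr M) (pull M (N \<uplus> M) (inr M) x) k) = x"
proof (rule rvec_eqI)
  fix k assume k: "k \<in> N \<uplus> M"
  have fibres: "{i\<in>N. inl N i = k} = {i\<in>N. InL i = k}" "{i\<in>M. inr M i = k} = {i\<in>M. InR i = k}"
    by (auto simp: inl_def inr_def)
  have l: "push N (N \<uplus> M) (inl N) (pull N (N \<uplus> M) (inl N) x) k =
      (\<Sum>i\<in>{i\<in>N. InL i = k}. x (InL i))"
    using k assms by (simp add: push_def pull_def fibres)
  have r: "push M (N \<uplus> M) (inr M) (pull M (N \<uplus> M) (inr M) x) k =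
      (\<Sum>i\<in>{i\<in>M. InR i = k}. x (InR i))"
    using k assms by (simp add: push_def pull_def fibres)
  consider (l) i where "i \<in> N" "k = InL i" | (r) j where "j \<in> M" "k = InR j"
    using k by (auto simp: dsum_def)
  then have "(\<Sum>i\<in>{i\<in>N. InL i = k}. x (InL i)) + (\<Sum>i\<in>{i\<in>M. InR i = k}. x (InR i)) = x k"
  proof cases
    case l
    then have "{i'\<in>N. InL i' = k} = {i}" "{j\<in>M. InR j = k} = {}"
      by auto
    then show ?thesis using l by simp
  next
    case r
    then have "{i\<in>N. InL i = k} = {}" "{j'\<in>M. InR j' = k} = {j}"
      by auto
    then show ?thesis using r by simp
  qed
  with k show "(\<lambda>k\<in>N \<uplus> M. push N (N \<uplus> M) (inl N) (pull N (N \<uplus> M) (inl N) x) k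
    + push M (N \<uplus> M) (inr M) (pull M (N \<uplus> M) (inr M) x) k) k = x k"
    by (simp add: l r)
qed (use assms in auto)


section \<open>Set-valued functions form a commutative monoid\<close>

lemma mem_mink_sum_iff: "z \<in> mink_sum N A B \<longleftrightarrow> (\<exists>a\<in>A. \<exists>b\<in>B. z = (\<lambda>i\<in>N. a i + b i))"
  by (auto simp: mink_sum_def)

lemma bex_mink_sum_iff:
  "(\<exists>z\<in>mink_sum N A B. P z) \<longleftrightarrow> (\<exists>a\<in>A. \<exists>b\<in>B. P (\<lambda>i\<in>N. a i + b i))"
  unfolding mink_sum_def by blast

lemma mem_mink_scale_iff: "z \<in> mink_scale N c A \<longleftrightarrow> (\<exists>a\<in>A. z = (\<lambda>i\<in>N. c * a i))"
  by (auto simp: mink_scale_def)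

lemma bex_mink_scale_iff: "(\<exists>z\<in>mink_scale N c A. P z) \<longleftrightarrow> (\<exists>a\<in>A. P (\<lambda>i\<in>N. c * a i))"
  unfolding mink_scale_def by blast

lemma mink_sum_singleton: "mink_sum N {a} {b} = {\<lambda>i\<in>N. a i + b i}"
  by (auto simp: mem_mink_sum_iff)

lemma mink_scale_singleton: "mink_scale N c {a} = {\<lambda>i\<in>N. c * a i}"
  by (auto simp: mem_mink_scale_iff)

lemma mink_sum_subset: "mink_sum N A B \<subseteq> rvec N"
  by (auto simp: mem_mink_sum_iff)

lemma mink_scale_subset: "mink_scale N c A \<subseteq> rvec N"
  by (auto simp: mem_mink_scale_iff)

lemma mink_sum_commute: "mink_sum N A B = mink_sum N B A"
  by (rule set_eqI) (subst (1 2) mem_mink_sum_iff, subst add.commute, blast)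

lemma mink_sum_assoc: "mink_sum N (mink_sum N A B) C = mink_sum N A (mink_sum N B C)"
proof -
  have *: "(\<lambda>i\<in>N. (\<lambda>i\<in>N. a i + b i) i + c i) = (\<lambda>i\<in>N. a i + (\<lambda>i\<in>N. b i + c i) i)"
    for a b c :: "'a \<Rightarrow> real"
    by (auto simp: restrict_def add.assoc)
  have "z \<in> mink_sum N (mink_sum N A B) C \<longleftrightarrow>
      (\<exists>a\<in>A. \<exists>b\<in>B. \<exists>c\<in>C. z = (\<lambda>i\<in>N. (\<lambda>i\<in>N. a i + b i) i + c i))" for z
    unfolding mem_mink_sum_iff[of _ _ "mink_sum N A B"] bex_mink_sum_iff ..
  moreover have "z \<in> mink_sum N A (mink_sum N B C) \<longleftrightarrow>
      (\<exists>a\<in>A. \<exists>b\<in>B. \<exists>c\<in>C. z = (\<lambda>i\<in>N. a i + (\<lambda>i\<in>N. b i + c i) i))" for z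
    unfolding mem_mink_sum_iff[of _ _ A] bex_mink_sum_iff ..
  ultimately show ?thesis
    unfolding * by blast
qed

lemma mink_sum_zero:
  assumes "A \<subseteq> rvec N"
  shows "mink_sum N A {\<lambda>i\<in>N. 0} = A"
proof -
  have "(\<lambda>i\<in>N. a i + (\<lambda>i\<in>N. 0) i) = a" if "a \<in> A" for a
    using assms that by (intro rvec_eqI[where N = N]) auto
  then show ?thesis
    by (auto simp: mem_mink_sum_iff)
qed

lemma mink_scale_sum:
  "mink_scale N c (mink_sum N A B) = mink_sum N (mink_scale N c A) (mink_scale N c B)"
proof -
  have *: "(\<lambda>i\<in>N. c * (\<lambda>i\<in>N. a i + b i) i) = (\<lambda>i\<in>N. (\<lambda>i\<in>N. c * a i) i + (\<lambda>i\<in>N. c * b i) i)"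
    for a b :: "'a \<Rightarrow> real"
    by (auto simp: restrict_def distrib_left)
  have "z \<in> mink_scale N c (mink_sum N A B) \<longleftrightarrow>
      (\<exists>a\<in>A. \<exists>b\<in>B. z = (\<lambda>i\<in>N. c * (\<lambda>i\<in>N. a i + b i) i))" for z
    unfolding mem_mink_scale_iff bex_mink_sum_iff ..
  moreover have "z \<in> mink_sum N (mink_scale N c A) (mink_scale N c B) \<longleftrightarrow>
      (\<exists>a\<in>A. \<exists>b\<in>B. z = (\<lambda>i\<in>N. (\<lambda>i\<in>N. c * a i) i + (\<lambda>i\<in>N. c * b i) i))" for z
    unfolding mem_mink_sum_iff bex_mink_scale_iff ..
  ultimately show ?thesis
    unfolding * by blast
qed

definition sv_zero :: "'b set \<Rightarrow> 'b svfun"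
  where "sv_zero N = (\<lambda>x\<in>rvec N. {\<lambda>i\<in>N. 0})"

lemma svfuns_apply_subset: "\<upsilon> \<in> svfuns N \<Longrightarrow> x \<in> rvec N \<Longrightarrow> \<upsilon> x \<subseteq> rvec N"
  by (auto simp: svfuns_def)

lemma svfuns_eqI:
  "\<upsilon> \<in> svfuns N \<Longrightarrow> \<rho> \<in> svfuns N \<Longrightarrow> (\<And>x. x \<in> rvec N \<Longrightarrow> \<upsilon> x = \<rho> x) \<Longrightarrow> \<upsilon> = \<rho>"
  unfolding svfuns_def by (rule PiE_ext)

lemma svfuns_restrict_memI: "(\<And>x. x \<in> rvec N \<Longrightarrow> f x \<subseteq> rvec N) \<Longrightarrow> (\<lambda>x\<in>rvec N. f x) \<in> svfuns N"
  by (auto simp: svfuns_def)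

lemma sv_sum_mem [simp]: "sv_sum N \<upsilon> \<rho> \<in> svfuns N"
  unfolding sv_sum_def by (intro svfuns_restrict_memI mink_sum_subset)

lemma sv_scale_mem [simp]: "sv_scale N c \<upsilon> \<in> svfuns N"
  unfolding sv_scale_def by (intro svfuns_restrict_memI mink_scale_subset)

lemma sv_eta_mem [simp]: "sv_eta N \<in> svfuns N"
  unfolding sv_eta_def by (intro svfuns_restrict_memI) simp

lemma sv_diff_mem [simp]: "sv_diff N \<upsilon> \<rho> \<in> svfuns N"
  unfolding sv_diff_def mink_diff_def by (intro svfuns_restrict_memI mink_sum_subset)

lemma sv_sum_commute: "sv_sum N \<upsilon> \<rho> = sv_sum N \<rho> \<upsilon>"
  unfolding sv_sum_def by (subst mink_sum_commute) (rule refl)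

lemma sv_sum_assoc: "sv_sum N (sv_sum N \<upsilon> \<rho>) \<sigma> = sv_sum N \<upsilon> (sv_sum N \<rho> \<sigma>)"
  by (rule svfuns_eqI[where N = N]) (simp_all, simp add: sv_sum_def mink_sum_assoc)

lemma sv_sum_left_commute: "sv_sum N \<upsilon> (sv_sum N \<rho> \<sigma>) = sv_sum N \<rho> (sv_sum N \<upsilon> \<sigma>)"
  by (metis sv_sum_assoc sv_sum_commute)

lemma sv_sum_zero_right:
  assumes "\<upsilon> \<in> svfuns N"
  shows "sv_sum N \<upsilon> (sv_zero N) = \<upsilon>"
  by (rule svfuns_eqI[where N = N])
    (simp_all add: assms, simp add: sv_sum_def sv_zero_def mink_sum_zero svfuns_apply_subset assms)

lemma sv_scale_sum:
  "sv_scale N c (sv_sum N \<upsilon> \<rho>) = sv_sum N (sv_scale N c \<upsilon>) (sv_scale N c \<rho>)"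
  by (rule svfuns_eqI[where N = N]) (simp_all, simp add: sv_sum_def sv_scale_def mink_scale_sum)

lemma sv_diff_eq_sum_scale: "sv_diff N \<upsilon> \<rho> = sv_sum N \<upsilon> (sv_scale N (- 1) \<rho>)"
  by (rule svfuns_eqI[where N = N])
    (simp_all, simp add: sv_diff_def mink_diff_def sv_sum_def sv_scale_def)

text \<open>
  Among set-valued functions only those with singleton values have an additive inverse; this is
  what makes the translation by \<open>\<eta>\<close> invertible.
\<close>

lemma sv_eta_minus_eta: "sv_sum N (sv_eta N) (sv_scale N (- 1) (sv_eta N)) = sv_zero N"
  by (auto simp: sv_sum_def sv_eta_def sv_scale_def sv_zero_def mink_sum_singleton
      mink_scale_singleton intro!: restrict_ext)

lemma sv_diff_eta_of_sum_eta:
  assumes "\<upsilon> \<in> svfuns N"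
  shows "sv_diff N (sv_sum N (sv_eta N) \<upsilon>) (sv_eta N) = \<upsilon>"
proof -
  have "sv_diff N (sv_sum N (sv_eta N) \<upsilon>) (sv_eta N) =
      sv_sum N \<upsilon> (sv_sum N (sv_eta N) (sv_scale N (- 1) (sv_eta N)))"
    by (simp add: sv_diff_eq_sum_scale sv_sum_assoc sv_sum_left_commute)
  with assms show ?thesis
    by (simp add: sv_eta_minus_eta sv_sum_zero_right)
qed

lemma sum_eta_of_sv_diff_eta:
  assumes "\<upsilon> \<in> svfuns N"
  shows "sv_sum N (sv_eta N) (sv_diff N \<upsilon> (sv_eta N)) = \<upsilon>"
proof -
  have "sv_sum N (sv_eta N) (sv_diff N \<upsilon> (sv_eta N)) =
      sv_sum N \<upsilon> (sv_sum N (sv_eta N) (sv_scale N (- 1) (sv_eta N)))"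
    by (simp add: sv_diff_eq_sum_scale sv_sum_left_commute)
  with assms show ?thesis
    by (simp add: sv_eta_minus_eta sv_sum_zero_right)
qed


section \<open>Pushforward of set-valued functions\<close>

lemma sv_push_mem [simp]:
  assumes "\<phi> \<in> N \<rightarrow> M" "\<upsilon> \<in> svfuns N"
  shows "sv_push N M \<phi> \<upsilon> \<in> svfuns M"
  unfolding sv_push_def
  using assms by (blast intro: svfuns_restrict_memI push_mem pull_mem dest: svfuns_apply_subset)

lemma sv_push_id:
  assumes "\<upsilon> \<in> svfuns N"
  shows "sv_push N N (\<lambda>i\<in>N. i) \<upsilon> = \<upsilon>"
proof (rule svfuns_eqI)
  fix x assume x: "x \<in> rvec N"
  then have "push N N (\<lambda>i\<in>N. i) ` \<upsilon> x = (\<lambda>v. v) ` \<upsilon> x"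
    using svfuns_apply_subset[OF assms x] by (intro image_cong) (auto simp: push_id)
  with x show "sv_push N N (\<lambda>i\<in>N. i) \<upsilon> x = \<upsilon> x"
    by (simp add: sv_push_def pull_id)
qed (use assms in auto)

lemma sv_push_compose:
  assumes "finite N" "finite M" "\<phi> \<in> N \<rightarrow> M" "\<psi> \<in> M \<rightarrow> K" "\<upsilon> \<in> svfuns N"
  shows "sv_push M K \<psi> (sv_push N M \<phi> \<upsilon>) = sv_push N K (compose N \<psi> \<phi>) \<upsilon>"
proof (rule svfuns_eqI)
  fix z assume z: "z \<in> rvec K"
  have w: "pull N K (compose N \<psi> \<phi>) z \<in> rvec N"
    using assms z by (auto intro!: pull_mem simp: compose_def)
  have "push M K \<psi> ` push N M \<phi> ` \<upsilon> (pull N K (compose N \<psi> \<phi>) z) =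
      push N K (compose N \<psi> \<phi>) ` \<upsilon> (pull N K (compose N \<psi> \<phi>) z)"
    unfolding image_image
    using svfuns_apply_subset[OF assms(5) w] assms by (intro image_cong) (auto simp: push_compose)
  with assms z show "sv_push M K \<psi> (sv_push N M \<phi> \<upsilon>) z = sv_push N K (compose N \<psi> \<phi>) \<upsilon> z"
    by (simp add: sv_push_def pull_mem pull_compose)
qed (use assms in \<open>auto intro!: sv_push_mem simp: compose_eq\<close>)

lemma sv_push_sum:
  assumes "\<phi> \<in> N \<rightarrow> M" "\<upsilon> \<in> svfuns N" "\<rho> \<in> svfuns N"
  shows "sv_push N M \<phi> (sv_sum N \<upsilon> \<rho>) = sv_sum M (sv_push N M \<phi> \<upsilon>) (sv_push N M \<phi> \<rho>)"
proof (rule svfuns_eqI)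
  fix y assume y: "y \<in> rvec M"
  have w: "pull N M \<phi> y \<in> rvec N"
    using assms y by (auto intro: pull_mem)
  have "push N M \<phi> ` mink_sum N A B = mink_sum M (push N M \<phi> ` A) (push N M \<phi> ` B)"
    if "A \<subseteq> rvec N" "B \<subseteq> rvec N" for A B
  proof -
    have *: "push N M \<phi> (\<lambda>i\<in>N. a i + b i) = (\<lambda>j\<in>M. push N M \<phi> a j + push N M \<phi> b j)"
      if "a \<in> A" "b \<in> B" for a b
      using that \<open>A \<subseteq> rvec N\<close> \<open>B \<subseteq> rvec N\<close> by (intro push_add) auto
    have "z \<in> push N M \<phi> ` mink_sum N A B \<longleftrightarrow>
        (\<exists>a\<in>A. \<exists>b\<in>B. z = push N M \<phi> (\<lambda>i\<in>N. a i + b i))" for z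
      unfolding image_iff Bex_def mem_mink_sum_iff by blast
    moreover have "z \<in> mink_sum M (push N M \<phi> ` A) (push N M \<phi> ` B) \<longleftrightarrow>
        (\<exists>a\<in>A. \<exists>b\<in>B. z = (\<lambda>j\<in>M. push N M \<phi> a j + push N M \<phi> b j))" for z
      by (simp add: mem_mink_sum_iff)
    ultimately show ?thesis
      using * by (intro set_eqI) (simp cong: bex_cong)
  qed
  with y w show "sv_push N M \<phi> (sv_sum N \<upsilon> \<rho>) y =
      sv_sum M (sv_push N M \<phi> \<upsilon>) (sv_push N M \<phi> \<rho>) y"
    using assms by (simp add: sv_push_def sv_sum_def svfuns_apply_subset)
qed (use assms in auto)

lemma sv_push_scale:
  assumes "\<phi> \<in> N \<rightarrow> M" "\<upsilon> \<in> svfuns N"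
  shows "sv_push N M \<phi> (sv_scale N c \<upsilon>) = sv_scale M c (sv_push N M \<phi> \<upsilon>)"
proof (rule svfuns_eqI)
  fix y assume y: "y \<in> rvec M"
  have w: "pull N M \<phi> y \<in> rvec N"
    using assms y by (auto intro: pull_mem)
  have *: "push N M \<phi> (\<lambda>i\<in>N. c * a i) = (\<lambda>j\<in>M. c * push N M \<phi> a j)"
    if "a \<in> \<upsilon> (pull N M \<phi> y)" for a
    using that svfuns_apply_subset[OF assms(2) w] by (intro push_scale) auto
  have "push N M \<phi> ` mink_scale N c (\<upsilon> (pull N M \<phi> y)) =
      mink_scale M c (push N M \<phi> ` \<upsilon> (pull N M \<phi> y))"
    by (force simp: mink_scale_def image_iff *)
  with y w show "sv_push N M \<phi> (sv_scale N c \<upsilon>) y = sv_scale M c (sv_push N M \<phi> \<upsilon>) y"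
    by (simp add: sv_push_def sv_scale_def)
qed (use assms in auto)

lemma sv_unit_cmp_eq_zero: "sv_unit_cmp () = sv_zero {}"
  by (simp add: sv_unit_cmp_def sv_zero_def)

lemma sv_push_empty_zero: "sv_push {} N \<phi> (sv_zero {}) = sv_zero N"
  by (auto simp: sv_push_def sv_zero_def push_def pull_mem pull_def fun_eq_iff)


section \<open>The product comparison\<close>

lemma inl_Pi [simp]: "inl N \<in> N \<rightarrow> N \<uplus> M"
  and inr_Pi [simp]: "inr M \<in> M \<rightarrow> N \<uplus> M"
  by (auto simp: inl_def inr_def dsum_def)

lemma sv_prod_cmp_apply:
  assumes "\<upsilon> \<in> svfuns N" "\<rho> \<in> svfuns M"
  shows "sv_prod_cmp N M (\<upsilon>, \<rho>) =
    sv_sum (N \<uplus> M) (sv_push N (N \<uplus> M) (inl N) \<upsilon>) (sv_push M (N \<uplus> M) (inr M) \<rho>)"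
  using assms by (simp add: sv_prod_cmp_def)

lemma sv_prod_cmp_PiE: "sv_prod_cmp N M \<in> svfuns N \<times> svfuns M \<rightarrow>\<^sub>E svfuns (N \<uplus> M)"
  by (auto simp: sv_prod_cmp_def)

lemma sv_prod_cmp_mem [simp]:
  "\<upsilon> \<in> svfuns N \<Longrightarrow> \<rho> \<in> svfuns M \<Longrightarrow> sv_prod_cmp N M (\<upsilon>, \<rho>) \<in> svfuns (N \<uplus> M)"
  by (simp add: sv_prod_cmp_apply)

lemma sv_prod_cmp_sum:
  assumes "\<upsilon> \<in> svfuns N" "\<upsilon>' \<in> svfuns N" "\<rho> \<in> svfuns M" "\<rho>' \<in> svfuns M"
  shows "sv_prod_cmp N M (sv_sum N \<upsilon> \<upsilon>', sv_sum M \<rho> \<rho>') =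
    sv_sum (N \<uplus> M) (sv_prod_cmp N M (\<upsilon>, \<rho>)) (sv_prod_cmp N M (\<upsilon>', \<rho>'))"
  using assms
  by (simp add: sv_prod_cmp_apply sv_push_sum sv_sum_assoc sv_sum_left_commute)

lemma sv_prod_cmp_scale:
  assumes "\<upsilon> \<in> svfuns N" "\<rho> \<in> svfuns M"
  shows "sv_prod_cmp N M (sv_scale N c \<upsilon>, sv_scale M c \<rho>) =
    sv_scale (N \<uplus> M) c (sv_prod_cmp N M (\<upsilon>, \<rho>))"
  using assms by (simp add: sv_prod_cmp_apply sv_push_scale sv_scale_sum)

lemma sv_prod_cmp_eta: "sv_prod_cmp N M (sv_eta N, sv_eta M) = sv_eta (N \<uplus> M)"
proof (rule svfuns_eqI)
  fix x :: "'a elem \<Rightarrow> real" assume "x \<in> rvec (N \<uplus> M)"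
  then show "sv_prod_cmp N M (sv_eta N, sv_eta M) x = sv_eta (N \<uplus> M) x"
    by (simp add: sv_prod_cmp_apply)
      (simp add: sv_sum_def sv_push_def sv_eta_def pull_mem mink_sum_singleton
        push_pull_inl_plus_push_pull_inr)
qed auto

text \<open>
  A map out of \<open>N \<uplus> M\<close> is determined by its two legs, and additivity and functoriality of
  \<open>sv_push\<close> make the pushed forward comparison depend on them separately. Since the structure maps
  of the disjoint union are copairings, each coherence axiom for \<open>NDD\<close> becomes a comparison of
  legs.
\<close>

lemma sv_push_sv_prod_cmp:
  assumes "finite N" "finite M" "\<chi> \<in> N \<uplus> M \<rightarrow> K" "\<upsilon> \<in> svfuns N" "\<rho> \<in> svfuns M"
  shows "sv_push (N \<uplus> M) K \<chi> (sv_prod_cmp N M (\<upsilon>, \<rho>)) =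
    sv_sum K (sv_push N K (compose N \<chi> (inl N)) \<upsilon>) (sv_push M K (compose M \<chi> (inr M)) \<rho>)"
  using assms by (simp add: sv_prod_cmp_apply sv_push_sum sv_push_compose)

lemma copair_compose_inl [simp]: "compose N (copair N M f g) (inl N) = restrict f N"
  and copair_compose_inr [simp]: "compose M (copair N M f g) (inr M) = restrict g M"
  by (auto simp: copair_def inl_def inr_def compose_def dsum_def fun_eq_iff)

interpretation NDD: lax_symmetric_monoidal_functor NDD
proof
  fix N M :: "'a elem set" and \<phi>
  assume "finite N" "finite M" "\<phi> \<in> N \<rightarrow>\<^sub>E M"
  then show "arr NDD N M \<phi> \<in> obj NDD N \<rightarrow>\<^sub>E obj NDD M"
    by (auto simp: NDD_def intro!: sv_push_mem)
next
  fix N :: "'a elem set"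
  show "arr NDD N N (\<lambda>i\<in>N. i) = (\<lambda>x\<in>obj NDD N. x)"
    by (auto simp: NDD_def sv_push_id fun_eq_iff restrict_def[where A = "svfuns N"])
next
  fix N M K :: "'a elem set" and \<phi> \<psi>
  assume "finite N" "finite M" "finite K" "\<phi> \<in> N \<rightarrow>\<^sub>E M" "\<psi> \<in> M \<rightarrow>\<^sub>E K"
  then have "finite N" "finite M" "\<phi> \<in> N \<rightarrow> M" "\<psi> \<in> M \<rightarrow> K"
    by auto
  then show "arr NDD N K (compose N \<psi> \<phi>) = compose (obj NDD N) (arr NDD M K \<psi>) (arr NDD N M \<phi>)"
    by (auto simp: NDD_def compose_def[where A = "svfuns N"] sv_push_compose fun_eq_iff)
next
  fix N M :: "'a elem set"
  show "prod_cmp NDD N M \<in> obj NDD N \<times> obj NDD M \<rightarrow>\<^sub>E obj NDD (N \<uplus> M)"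
    by (simp add: NDD_def sv_prod_cmp_PiE)
next
  show "unit_cmp NDD \<in> UNIV \<rightarrow> obj NDD {}"
    by (auto simp: NDD_def sv_unit_cmp_def svfuns_def)
next
  fix N M N' M' :: "'a elem set" and \<phi> \<psi> x y
  assume fin: "finite N" "finite M" "finite N'" "finite M'"
    and arrs: "\<phi> \<in> N \<rightarrow>\<^sub>E N'" "\<psi> \<in> M \<rightarrow>\<^sub>E M'"
    and xy: "x \<in> obj NDD N" "y \<in> obj NDD M"
  have "restrict (InL \<circ> \<phi>) N = compose N (inl N') \<phi>" "restrict (InR \<circ> \<psi>) M = compose M (inr M') \<psi>"
    using arrs by (auto simp: compose_def inl_def inr_def fun_eq_iff restrict_def)
  moreover have "dsum_map N M \<phi> \<psi> \<in> N \<uplus> M \<rightarrow> N' \<uplus> M'" "\<phi> \<in> N \<rightarrow> N'" "\<psi> \<in> M \<rightarrow> M'"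
    using dsum_map_mem[OF arrs] arrs by auto
  ultimately show "arr NDD (N \<uplus> M) (N' \<uplus> M') (dsum_map N M \<phi> \<psi>) (prod_cmp NDD N M (x, y)) =
      prod_cmp NDD N' M' (arr NDD N N' \<phi> x, arr NDD M M' \<psi> y)"
    using fin xy
    by (simp add: NDD_def sv_push_sv_prod_cmp)
      (simp add: dsum_map_def sv_prod_cmp_apply sv_push_compose)
next
  fix N M K :: "'a elem set" and x y z
  assume fin: "finite N" "finite M" "finite K"
    and xyz: "x \<in> obj NDD N" "y \<in> obj NDD M" "z \<in> obj NDD K"
  let ?X = "N \<uplus> (M \<uplus> K)"
  have x: "x \<in> svfuns N" and y: "y \<in> svfuns M" and z: "z \<in> svfuns K"
    using xyz by (auto simp: NDD_def)
  have assoc_Pi: "dsum_assoc N M K \<in> (N \<uplus> M) \<uplus> K \<rightarrow> ?X"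
    and inner_Pi: "copair N M InL (InR \<circ> InL) \<in> N \<uplus> M \<rightarrow> ?X"
    using dsum_assoc_mem[of N M K] dsum_assoc_inner_mem[of N M K] by auto
  have assoc_inl: "compose (N \<uplus> M) (dsum_assoc N M K) (inl (N \<uplus> M)) = copair N M InL (InR \<circ> InL)"
    unfolding dsum_assoc_def copair_compose_inl by (auto simp: copair_def)
  have legs: "restrict InL N = inl N"
    "restrict (InR \<circ> InL) M = compose M (inr (M \<uplus> K)) (inl M)"
    "compose K (dsum_assoc N M K) (inr K) = compose K (inr (M \<uplus> K)) (inr K)"
    unfolding dsum_assoc_def copair_compose_inr
    by (auto simp: inl_def inr_def compose_def fun_eq_iff restrict_def dsum_def)
  have "sv_push ((N \<uplus> M) \<uplus> K) ?X (dsum_assoc N M K)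
        (sv_prod_cmp (N \<uplus> M) K (sv_prod_cmp N M (x, y), z)) =
      sv_sum ?X (sv_push (N \<uplus> M) ?X (copair N M InL (InR \<circ> InL)) (sv_prod_cmp N M (x, y)))
        (sv_push K ?X (compose K (inr (M \<uplus> K)) (inr K)) z)"
    using fin x y z assoc_Pi by (simp add: sv_push_sv_prod_cmp assoc_inl legs)
  also have "\<dots> = sv_sum ?X
      (sv_sum ?X (sv_push N ?X (inl N) x) (sv_push M ?X (compose M (inr (M \<uplus> K)) (inl M)) y))
      (sv_push K ?X (compose K (inr (M \<uplus> K)) (inr K)) z)"
    using fin x y inner_Pi by (simp add: sv_push_sv_prod_cmp legs)
  also have "\<dots> = sv_sum ?X (sv_push N ?X (inl N) x)
      (sv_push (M \<uplus> K) ?X (inr (M \<uplus> K)) (sv_prod_cmp M K (y, z)))"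
    using fin y z by (simp add: sv_push_sv_prod_cmp sv_sum_assoc)
  also have "\<dots> = sv_prod_cmp N (M \<uplus> K) (x, sv_prod_cmp M K (y, z))"
    using x y z by (simp add: sv_prod_cmp_apply)
  finally show "arr NDD ((N \<uplus> M) \<uplus> K) (N \<uplus> (M \<uplus> K)) (dsum_assoc N M K)
        (prod_cmp NDD (N \<uplus> M) K (prod_cmp NDD N M (x, y), z)) =
      prod_cmp NDD N (M \<uplus> K) (x, prod_cmp NDD M K (y, z))"
    using x y z by (simp add: NDD_def)
next
  fix N :: "'a elem set" and x
  assume fin: "finite N" and "x \<in> obj NDD N"
  then have x: "x \<in> svfuns N" by (simp add: NDD_def)
  have "sv_zero {} \<in> svfuns ({} :: 'a elem set)" "dsum_lunit N \<in> {} \<uplus> N \<rightarrow> N"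
    using dsum_lunit_mem[of N] by (auto simp: sv_zero_def svfuns_def)
  with fin x show "arr NDD ({} \<uplus> N) N (dsum_lunit N) (prod_cmp NDD {} N (unit_cmp NDD (), x)) = x"
    by (simp add: NDD_def sv_unit_cmp_eq_zero sv_push_sv_prod_cmp)
      (simp add: dsum_lunit_def sv_push_id sv_push_empty_zero sv_sum_zero_right
        sv_sum_commute[of N "sv_zero N"])
next
  fix N :: "'a elem set" and x
  assume fin: "finite N" and "x \<in> obj NDD N"
  then have x: "x \<in> svfuns N" by (simp add: NDD_def)
  have "sv_zero {} \<in> svfuns ({} :: 'a elem set)" "dsum_runit N \<in> N \<uplus> {} \<rightarrow> N"
    using dsum_runit_mem[of N] by (auto simp: sv_zero_def svfuns_def)
  with fin x show "arr NDD (N \<uplus> {}) N (dsum_runit N) (prod_cmp NDD N {} (x, unit_cmp NDD ())) = x"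
    by (simp add: NDD_def sv_unit_cmp_eq_zero sv_push_sv_prod_cmp)
      (simp add: dsum_runit_def sv_push_id sv_push_empty_zero sv_sum_zero_right)
next
  fix N M :: "'a elem set" and x y
  assume fin: "finite N" "finite M" and "x \<in> obj NDD N" "y \<in> obj NDD M"
  then have xy: "x \<in> svfuns N" "y \<in> svfuns M" by (simp_all add: NDD_def)
  have "dsum_swap N M \<in> N \<uplus> M \<rightarrow> M \<uplus> N"
    using dsum_swap_mem[of N M] by auto
  moreover have "restrict InR N = inr N" "restrict InL M = inl M"
    by (auto simp: inl_def inr_def)
  ultimately show "arr NDD (N \<uplus> M) (M \<uplus> N) (dsum_swap N M) (prod_cmp NDD N M (x, y)) =
      prod_cmp NDD M N (y, x)"
    using fin xy
    by (simp add: NDD_def sv_push_sv_prod_cmp)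
      (simp add: dsum_swap_def sv_prod_cmp_apply sv_sum_commute)
qed


section \<open>Translation, scaling and the Euler transformation\<close>

lemma sv_scale_zero: "sv_scale N c (sv_zero N) = sv_zero N"
  by (auto simp: sv_scale_def sv_zero_def mink_scale_singleton intro!: restrict_ext)

lemma scaling_monoidal_natural_transformation:
  "monoidal_natural_transformation NDD NDD (\<lambda>N. \<lambda>\<upsilon>\<in>svfuns N. sv_scale N c \<upsilon>)"
proof
  fix N M :: "'a elem set" and \<phi>
  assume "finite N" "finite M" "\<phi> \<in> N \<rightarrow>\<^sub>E M"
  then have "\<phi> \<in> N \<rightarrow> M" by auto
  then show "compose (obj NDD N) (\<lambda>\<upsilon>\<in>svfuns M. sv_scale M c \<upsilon>) (arr NDD N M \<phi>) =
      compose (obj NDD N) (arr NDD N M \<phi>) (\<lambda>\<upsilon>\<in>svfuns N. sv_scale N c \<upsilon>)"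
    by (auto simp: NDD_def compose_def sv_push_scale fun_eq_iff)
next
  show "(\<lambda>\<upsilon>\<in>svfuns {}. sv_scale {} c \<upsilon>) (unit_cmp NDD ()) = unit_cmp NDD ()"
    using NDD.unit_cmp_mem by (auto simp: NDD_def sv_unit_cmp_eq_zero sv_scale_zero)
qed (auto simp: NDD_def sv_prod_cmp_scale)

lemma translation_monoidal_natural_transformation:
  "monoidal_natural_transformation NDD NDD_D (\<lambda>N. \<lambda>\<upsilon>\<in>svfuns N. sv_sum N (sv_eta N) \<upsilon>)"
proof (rule transport_of_structure[where s = "\<lambda>N \<upsilon>. sv_diff N \<upsilon> (sv_eta N)"])
  show "lax_symmetric_monoidal_functor NDD" ..
next
  fix N M :: "'a elem set" and \<phi>
  assume "finite N" "finite M" "\<phi> \<in> N \<rightarrow>\<^sub>E M"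
  then have "\<phi> \<in> N \<rightarrow> M" by auto
  then show "arr NDD_D N M \<phi> = (\<lambda>y\<in>obj NDD_D N.
      (\<lambda>\<upsilon>\<in>svfuns M. sv_sum M (sv_eta M) \<upsilon>) (arr NDD N M \<phi> (sv_diff N y (sv_eta N))))"
    by (auto simp: NDD_def NDD_D_def fun_eq_iff)
next
  fix N M :: "'a elem set" and x y
  assume "x \<in> obj NDD N" "y \<in> obj NDD M"
  then show "(\<lambda>\<upsilon>\<in>svfuns (N \<uplus> M). sv_sum (N \<uplus> M) (sv_eta (N \<uplus> M)) \<upsilon>) (prod_cmp NDD N M (x, y)) =
      prod_cmp NDD_D N M
        ((\<lambda>\<upsilon>\<in>svfuns N. sv_sum N (sv_eta N) \<upsilon>) x, (\<lambda>\<upsilon>\<in>svfuns M. sv_sum M (sv_eta M) \<upsilon>) y)"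
    by (simp add: NDD_def NDD_D_def sv_prod_cmp_sum sv_prod_cmp_eta)
next
  \<comment> \<open>The only vector on the empty set is \<open>0\<close>, so there \<open>\<eta>\<close> is itself the unit.\<close>
  have "rvec {} = {\<lambda>i\<in>{}. 0 :: real}"
    by (auto simp: rvec_def)
  then have "sv_eta {} = sv_zero {}"
    by (auto simp: sv_eta_def sv_zero_def intro!: restrict_ext)
  then show "(\<lambda>\<upsilon>\<in>svfuns {}. sv_sum {} (sv_eta {}) \<upsilon>) (unit_cmp NDD ()) = unit_cmp NDD_D ()"
    using NDD.unit_cmp_mem sv_eta_mem[of "{}"]
    by (auto simp: NDD_def NDD_D_def sv_unit_cmp_eq_zero sv_sum_zero_right)
qed (auto simp: NDD_def NDD_D_def sv_diff_eta_of_sum_eta sum_eta_of_sv_diff_eta sv_prod_cmp_PiE)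

theorem lemma5p5:
  fixes \<gamma> :: real
  assumes "\<gamma> > 0"
  shows "\<exists>Euler :: 'a elem set \<Rightarrow> 'a elem svfun \<Rightarrow> 'a elem svfun.
    monoidal_natural_transformation NDD NDD_D Euler \<and>
    (\<forall>N. finite N \<longrightarrow>
      (\<forall>\<upsilon> \<in> obj NDD N. Euler N \<upsilon> = sv_sum N (sv_eta N) (sv_scale N \<gamma> \<upsilon>)))"
proof (intro exI conjI allI impI ballI)
  show "monoidal_natural_transformation NDD NDD_D (\<lambda>N. compose (obj NDD N)
      (\<lambda>\<upsilon>\<in>svfuns N. sv_sum N (sv_eta N) \<upsilon>) (\<lambda>\<upsilon>\<in>svfuns N. sv_scale N \<gamma> \<upsilon>))"
    by (rule monoidal_natural_transformation_compose[OF
          scaling_monoidal_natural_transformation translation_monoidal_natural_transformation])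
qed (simp add: compose_def NDD_def)

end
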